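(* Let $G$ be a finite group and $n\ge 2$. For $2\le m\le n$: (i) $Z_{m,m-1,n}=\langle Z_{m-1,n},X_m\rangle$; (ii) $Z_{m,m-1,n}$ is commutative.
   Context: $G$ is a finite group with identity $e$. $G_n=G\sim S_n$ (wreath product) is the set of tuples $(g_1,\ldots,g_n,\pi)$ with $g_i\in G$, $\pi\in S_n$, and product $(g_1,\ldots,g_n,\pi)(h_1,\ldots,h_n,\tau)=(g_1h_{\pi^{-1}(1)},\ldots,g_nh_{\pi^{-1}(n)},\pi\tau)$. For $g\in G$, $g^{(i)}\in G_n$ has $g$ in position $i$, $e$ in the other positions, and identity permutation; $\pi\in S_n$ is identified with $(e,\ldots,e,\pi)$; $(k,i)$ denotes a transposition. For $1\le i\le n$, $H_{i,n}=\{(g_1,\ldots,g_n,\pi)\in G_n: \pi(j)=j\text{ for } i+1\le j\le n\}$, so $H_{n,n}=G_n$. $Z_{m,n}$ is the center of the group algebra $\mathbb{C}[H_{m,n}]$. $Z_{m,m-1,n}=\{a\in\mathbb{C}[H_{m,n}] : ab=ba \text{ for all } b\in\mathbb{C}[H_{m-1,n}]\}$ is the relative commutant. The Young-Jucys-Murphy elements are $X_i=\sum_{k=1}^{i-1}\sum_{g\in G}(g^{-1})^{(k)}g^{(i)}(k,i)\in\mathbb{C}[G_n]$, $1\le i\le n$ (so $X_1=0$). $\langle\cdot\rangle$ denotes the generated unital subalgebra. *)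

theory Defs
  imports Complex_Main "HOL-Algebra.Sym_Groups" "HOL-Algebra.Subrings" "HOL-Algebra.Module"
begin

subsection \<open>The wreath product of a group with a symmetric group\<close>

text \<open>An element \<open>(g\<^sub>1, \<dots>, g\<^sub>n, \<pi>)\<close> is a pair of an extensional function on \<open>{1..n}\<close> and a
  permutation of \<open>{1..n}\<close> (a function on all naturals fixing everything outside \<open>{1..n}\<close>).\<close>

type_synonym 'a wreath_elem = "(nat \<Rightarrow> 'a) \<times> (nat \<Rightarrow> nat)"

definition wreath :: "('a, 'x) monoid_scheme \<Rightarrow> nat \<Rightarrow> 'a wreath_elem monoid" where
  "wreath G n =
     \<lparr> carrier = ({1..n} \<rightarrow>\<^sub>E carrier G) \<times> carrier (sym_group n),
       mult = (\<lambda>(g, \<pi>) (h, \<tau>).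
         ((\<lambda>i\<in>{1..n}. g i \<otimes>\<^bsub>G\<^esub> h (Hilbert_Choice.inv \<pi> i)), \<pi> \<otimes>\<^bsub>sym_group n\<^esub> \<tau>)),
       one = ((\<lambda>i\<in>{1..n}. \<one>\<^bsub>G\<^esub>), \<one>\<^bsub>sym_group n\<^esub>) \<rparr>"

definition wr_base :: "('a, 'x) monoid_scheme \<Rightarrow> nat \<Rightarrow> nat \<Rightarrow> 'a \<Rightarrow> 'a wreath_elem" where
  "wr_base G n i g = ((\<lambda>j\<in>{1..n}. if j = i then g else \<one>\<^bsub>G\<^esub>), id)"

definition wr_perm :: "('a, 'x) monoid_scheme \<Rightarrow> nat \<Rightarrow> (nat \<Rightarrow> nat) \<Rightarrow> 'a wreath_elem" where
  "wr_perm G n \<pi> = ((\<lambda>j\<in>{1..n}. \<one>\<^bsub>G\<^esub>), \<pi>)"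

text \<open>In \<open>wr_sub G i n\<close> only the permutation is restricted: the base components at the positions
  \<open>i + 1, \<dots>, n\<close> remain arbitrary.\<close>

definition wr_sub :: "('a, 'x) monoid_scheme \<Rightarrow> nat \<Rightarrow> nat \<Rightarrow> 'a wreath_elem set" where
  "wr_sub G i n = {(g, \<pi>) \<in> carrier (wreath G n). \<forall>j\<in>{i + 1..n}. \<pi> j = j}"


subsection \<open>Complex group algebras\<close>

text \<open>For a finite group \<open>K\<close>, an element of the group algebra is its coefficient function, extended
  by \<open>0\<close> off the carrier; multiplication is convolution.\<close>

definition group_algebra :: "('k, 'x) monoid_scheme \<Rightarrow> (complex, 'k \<Rightarrow> complex) module" where
  "group_algebra K =
     \<lparr> carrier = {a. \<forall>x. x \<notin> carrier K \<longrightarrow> a x = 0},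
       mult = (\<lambda>a b x. \<Sum>(y, z) \<in> {(y, z) \<in> carrier K \<times> carrier K. y \<otimes>\<^bsub>K\<^esub> z = x}. a y * b z),
       one = (\<lambda>x. if x = \<one>\<^bsub>K\<^esub> then 1 else 0),
       zero = (\<lambda>x. 0),
       add = (\<lambda>a b x. a x + b x),
       smult = (\<lambda>c a x. c * a x) \<rparr>"

definition ga_basis :: "'k \<Rightarrow> 'k \<Rightarrow> complex" where
  "ga_basis y = (\<lambda>x. if x = y then 1 else 0)"

text \<open>The group algebra of a subgroup \<open>H\<close> of \<open>K\<close>, as a subalgebra of that of \<open>K\<close>.\<close>

definition ga_sub :: "('k, 'x) monoid_scheme \<Rightarrow> 'k set \<Rightarrow> ('k \<Rightarrow> complex) set" where
  "ga_sub K H = {a \<in> carrier (group_algebra K). \<forall>x. x \<notin> H \<longrightarrow> a x = 0}"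

definition unital_subalgebra :: "('c, 'b, 'x) module_scheme \<Rightarrow> 'c set \<Rightarrow> 'b set \<Rightarrow> bool" where
  "unital_subalgebra A F B \<longleftrightarrow> subring B A \<and> (\<forall>c\<in>F. \<forall>b\<in>B. c \<odot>\<^bsub>A\<^esub> b \<in> B)"

definition generated_subalgebra :: "('c, 'b, 'x) module_scheme \<Rightarrow> 'c set \<Rightarrow> 'b set \<Rightarrow> 'b set" where
  "generated_subalgebra A F S = \<Inter>{B. unital_subalgebra A F B \<and> S \<subseteq> B}"

definition commutant :: "('b, 'x) monoid_scheme \<Rightarrow> 'b set \<Rightarrow> 'b set \<Rightarrow> 'b set" where
  "commutant A S T = {a \<in> S. \<forall>b\<in>T. a \<otimes>\<^bsub>A\<^esub> b = b \<otimes>\<^bsub>A\<^esub> a}"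


subsection \<open>Centers, relative commutants and Young--Jucys--Murphy elements\<close>

abbreviation wr_alg :: "('a, 'x) monoid_scheme \<Rightarrow> nat \<Rightarrow> (complex, 'a wreath_elem \<Rightarrow> complex) module"
  where "wr_alg G n \<equiv> group_algebra (wreath G n)"

definition wr_center :: "('a, 'x) monoid_scheme \<Rightarrow> nat \<Rightarrow> nat \<Rightarrow> ('a wreath_elem \<Rightarrow> complex) set" where
  "wr_center G m n =
     commutant (wr_alg G n) (ga_sub (wreath G n) (wr_sub G m n)) (ga_sub (wreath G n) (wr_sub G m n))"

definition wr_rel_commutant ::
    "('a, 'x) monoid_scheme \<Rightarrow> nat \<Rightarrow> nat \<Rightarrow> nat \<Rightarrow> ('a wreath_elem \<Rightarrow> complex) set" where
  "wr_rel_commutant G m l n =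
     commutant (wr_alg G n) (ga_sub (wreath G n) (wr_sub G m n)) (ga_sub (wreath G n) (wr_sub G l n))"

definition YJM :: "('a, 'x) monoid_scheme \<Rightarrow> nat \<Rightarrow> nat \<Rightarrow> 'a wreath_elem \<Rightarrow> complex" where
  "YJM G n i =
     (\<lambda>x. \<Sum>k\<in>{1..<i}. \<Sum>g\<in>carrier G.
        ga_basis (wr_base G n k (inv\<^bsub>G\<^esub> g) \<otimes>\<^bsub>wreath G n\<^esub> wr_base G n i g
                  \<otimes>\<^bsub>wreath G n\<^esub> wr_perm G n (transpose k i)) x)"

end

theory Submission
  imports Defs
begin

text \<open>Write \<open>H\<close> and \<open>L\<close> for \<open>wr_sub G (m - 1) n\<close> and \<open>wr_sub G m n\<close>, \<open>X\<close> for the Young--Jucys--Murphy element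
  \<open>YJM G n m\<close>, and \<open>Z\<close> for the relative commutant.

  An element of the algebra of \<open>L\<close> lies in \<open>Z\<close> iff its coefficients are invariant under conjugation by
  \<open>H\<close>. Conjugation by \<open>H\<close> permutes the summands of \<open>X\<close>, which are the reflections exchanging the position
  \<open>m\<close> with a smaller one (lemma \<open>conj_reflection\<close>), so \<open>X \<in> Z\<close>; as \<open>Z\<close> is an algebra, it contains
  everything generated by \<open>X\<close> and the center.

  For the converse, put \<open>S x = (\<Sum>h\<in>H. h x h\<^sup>-\<^sup>1)\<close>. Averaging over \<open>H\<close> shows that the \<open>S x\<close> with \<open>x \<in> L\<close>
  span \<open>Z\<close>. That each of them is generated follows by induction on the number of positions below \<open>m\<close>
  that \<open>x\<close> moves or labels nontrivially. If the permutation of \<open>x\<close> fixes \<open>m\<close>, then \<open>x \<in> H\<close> and \<open>S x\<close>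
  is central. Otherwise \<open>x = y t\<close> with \<open>t\<close> a reflection in a position \<open>i\<close> that \<open>y\<close> leaves alone, and \<open>y\<close>
  has fewer active positions than \<open>x\<close>. Since \<open>X\<close> commutes with \<open>H\<close>, the product \<open>S y \<cdot> X\<close> is the sum of
  \<open>S (y t')\<close> over all reflections \<open>t'\<close> in \<open>X\<close> (lemma \<open>conj_sum_conv\<close>). If \<open>t'\<close> uses a position active in
  \<open>y\<close>, then \<open>y t'\<close> has no more active positions than \<open>y\<close> and the induction hypothesis applies; if not,
  then \<open>y t'\<close> is conjugate to \<open>x\<close> under \<open>H\<close> (lemma \<open>mult_reflection_conj\<close>), hence \<open>S (y t') = S x\<close>. So
  \<open>S y \<cdot> X\<close> is a positive multiple of \<open>S x\<close> plus generated terms, and \<open>S x\<close> is generated.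

  Commutativity follows because the generators commute: \<open>Z\<close> commutes with the algebra of \<open>H\<close>, in
  particular with its center, and \<open>X\<close> lies in \<open>Z\<close>.\<close>

section \<open>The algebra of a finite group\<close>

locale finite_group = group K for K (structure) +
  assumes finite_carrier [simp]: "finite (carrier K)"
begin

abbreviation "A \<equiv> group_algebra K"

lemma ga_carrier: "a \<in> carrier A \<longleftrightarrow> (\<forall>x. x \<notin> carrier K \<longrightarrow> a x = 0)"
  by (simp add: group_algebra_def)

lemma ga_add: "a \<oplus>\<^bsub>A\<^esub> b = (\<lambda>x. a x + b x)"
  and ga_zero: "\<zero>\<^bsub>A\<^esub> = (\<lambda>x. 0)"
  and ga_smult: "c \<odot>\<^bsub>A\<^esub> a = (\<lambda>x. c * a x)"
  and ga_one: "\<one>\<^bsub>A\<^esub> = (\<lambda>x. if x = \<one> then 1 else 0)"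
  by (simp_all add: group_algebra_def)

lemma inv_mult_eq_iff:
  assumes "x \<in> carrier K" "y \<in> carrier K" "z \<in> carrier K"
  shows "y \<otimes> z = x \<longleftrightarrow> z = inv y \<otimes> x"
  using assms by (metis inv_closed inv_solve_left m_closed)

lemma mult_inv_eq_iff:
  assumes "x \<in> carrier K" "y \<in> carrier K" "z \<in> carrier K"
  shows "y \<otimes> z = x \<longleftrightarrow> y = x \<otimes> inv z"
  using assms by (metis inv_closed inv_solve_right m_closed)

lemma conv_left:
  assumes "x \<in> carrier K"
  shows "(a \<otimes>\<^bsub>A\<^esub> b) x = (\<Sum>y\<in>carrier K. a y * b (inv y \<otimes> x))"
proof -
  have "{(y, z) \<in> carrier K \<times> carrier K. y \<otimes> z = x} = (\<lambda>y. (y, inv y \<otimes> x)) ` carrier K"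
    using assms by (auto simp: inv_mult_eq_iff image_iff m_assoc[symmetric])
  then show ?thesis
    by (simp add: group_algebra_def sum.reindex inj_on_def)
qed

lemma conv_right:
  assumes "x \<in> carrier K"
  shows "(a \<otimes>\<^bsub>A\<^esub> b) x = (\<Sum>y\<in>carrier K. a (x \<otimes> inv y) * b y)"
proof -
  have "{(y, z) \<in> carrier K \<times> carrier K. y \<otimes> z = x} = (\<lambda>z. (x \<otimes> inv z, z)) ` carrier K"
    using assms by (auto simp: mult_inv_eq_iff image_iff m_assoc)
  then show ?thesis
    by (simp add: group_algebra_def sum.reindex inj_on_def)
qed

lemma conv_outside:
  assumes "x \<notin> carrier K"
  shows "(a \<otimes>\<^bsub>A\<^esub> b) x = 0"
proof -
  have "{(y, z) \<in> carrier K \<times> carrier K. y \<otimes> z = x} = {}"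
    using assms by auto
  then show ?thesis
    by (simp only: group_algebra_def partial_object.simps monoid.simps sum.empty)
qed

lemma conv_closed: "a \<otimes>\<^bsub>A\<^esub> b \<in> carrier A"
  by (simp add: ga_carrier conv_outside)

lemma sum_carrier_mult_left:
  assumes "g \<in> carrier K"
  shows "(\<Sum>x\<in>carrier K. f (g \<otimes> x)) = (\<Sum>x\<in>carrier K. f x)"
  by (rule sum.reindex_bij_witness[where j = "\<lambda>x. g \<otimes> x" and i = "\<lambda>x. inv g \<otimes> x"])
    (use assms in \<open>auto simp: m_assoc[symmetric]\<close>)

lemma conv_assoc:
  "(a \<otimes>\<^bsub>A\<^esub> b) \<otimes>\<^bsub>A\<^esub> c = a \<otimes>\<^bsub>A\<^esub> (b \<otimes>\<^bsub>A\<^esub> c)"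
proof
  fix x
  show "((a \<otimes>\<^bsub>A\<^esub> b) \<otimes>\<^bsub>A\<^esub> c) x = (a \<otimes>\<^bsub>A\<^esub> (b \<otimes>\<^bsub>A\<^esub> c)) x"
  proof (cases "x \<in> carrier K")
    case True
    have "((a \<otimes>\<^bsub>A\<^esub> b) \<otimes>\<^bsub>A\<^esub> c) x
        = (\<Sum>u\<in>carrier K. \<Sum>p\<in>carrier K. a p * b (inv p \<otimes> u) * c (inv u \<otimes> x))"
      using True by (simp add: conv_left sum_distrib_right)
    also have "\<dots> = (\<Sum>p\<in>carrier K. \<Sum>u\<in>carrier K. a p * b (inv p \<otimes> u) * c (inv u \<otimes> x))"
      by (rule sum.swap)
    also have "\<dots> = (\<Sum>p\<in>carrier K. \<Sum>v\<in>carrier K. a p * b v * c (inv v \<otimes> (inv p \<otimes> x)))"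
    proof (rule sum.cong[OF refl])
      fix p assume p: "p \<in> carrier K"
      show "(\<Sum>u\<in>carrier K. a p * b (inv p \<otimes> u) * c (inv u \<otimes> x))
          = (\<Sum>v\<in>carrier K. a p * b v * c (inv v \<otimes> (inv p \<otimes> x)))"
        by (subst sum_carrier_mult_left[OF p, symmetric], rule sum.cong)
          (use p True in \<open>auto simp: m_assoc[symmetric] inv_mult_group\<close>)
    qed
    also have "\<dots> = (a \<otimes>\<^bsub>A\<^esub> (b \<otimes>\<^bsub>A\<^esub> c)) x"
      using True by (simp add: conv_left sum_distrib_left mult.assoc)
    finally show ?thesis .
  qed (simp add: conv_outside)
qed

lemma conv_one_left: "a \<in> carrier A \<Longrightarrow> \<one>\<^bsub>A\<^esub> \<otimes>\<^bsub>A\<^esub> a = a"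
  and conv_one_right: "a \<in> carrier A \<Longrightarrow> a \<otimes>\<^bsub>A\<^esub> \<one>\<^bsub>A\<^esub> = a"
proof -
  assume a: "a \<in> carrier A"
  have *: "(if P then 1 else 0) * z = (if P then z else 0)"
    "z * (if P then 1 else 0) = (if P then z else 0)" for P and z :: complex
    by auto
  show "\<one>\<^bsub>A\<^esub> \<otimes>\<^bsub>A\<^esub> a = a"
  proof
    fix x show "(\<one>\<^bsub>A\<^esub> \<otimes>\<^bsub>A\<^esub> a) x = a x"
      using a by (cases "x \<in> carrier K") (auto simp: conv_left conv_outside ga_one ga_carrier *)
  qed
  show "a \<otimes>\<^bsub>A\<^esub> \<one>\<^bsub>A\<^esub> = a"
  proof
    fix x show "(a \<otimes>\<^bsub>A\<^esub> \<one>\<^bsub>A\<^esub>) x = a x"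
      using a by (cases "x \<in> carrier K") (auto simp: conv_right conv_outside ga_one ga_carrier *)
  qed
qed

lemma conv_add_left: "(a \<oplus>\<^bsub>A\<^esub> b) \<otimes>\<^bsub>A\<^esub> c = (a \<otimes>\<^bsub>A\<^esub> c) \<oplus>\<^bsub>A\<^esub> (b \<otimes>\<^bsub>A\<^esub> c)"
  and conv_add_right: "c \<otimes>\<^bsub>A\<^esub> (a \<oplus>\<^bsub>A\<^esub> b) = (c \<otimes>\<^bsub>A\<^esub> a) \<oplus>\<^bsub>A\<^esub> (c \<otimes>\<^bsub>A\<^esub> b)"
  and conv_smult_left: "(s \<odot>\<^bsub>A\<^esub> a) \<otimes>\<^bsub>A\<^esub> b = s \<odot>\<^bsub>A\<^esub> (a \<otimes>\<^bsub>A\<^esub> b)"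
  and conv_smult_right: "a \<otimes>\<^bsub>A\<^esub> (s \<odot>\<^bsub>A\<^esub> b) = s \<odot>\<^bsub>A\<^esub> (a \<otimes>\<^bsub>A\<^esub> b)"
  by (simp_all add: group_algebra_def fun_eq_iff case_prod_unfold sum.distrib[symmetric]
      sum_distrib_left algebra_simps)

lemma ring_ga: "ring A"
proof (rule ringI)
  show "abelian_group A"
  proof (rule abelian_groupI)
    fix a assume "a \<in> carrier A"
    then show "\<exists>b\<in>carrier A. b \<oplus>\<^bsub>A\<^esub> a = \<zero>\<^bsub>A\<^esub>"
      by (intro bexI[of _ "\<lambda>x. - a x"]) (auto simp: ga_add ga_zero ga_carrier)
  qed (auto simp: ga_add ga_zero ga_carrier)
  show "monoid A"
    by (rule monoidI) (auto simp: conv_closed conv_assoc conv_one_left conv_one_right,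
        auto simp: ga_carrier ga_one)
qed (rule conv_add_left conv_add_right)+

lemma unital_subalgebraI:
  assumes "B \<subseteq> carrier A" "\<one>\<^bsub>A\<^esub> \<in> B"
    and "\<And>a b. a \<in> B \<Longrightarrow> b \<in> B \<Longrightarrow> a \<oplus>\<^bsub>A\<^esub> b \<in> B"
    and "\<And>a b. a \<in> B \<Longrightarrow> b \<in> B \<Longrightarrow> a \<otimes>\<^bsub>A\<^esub> b \<in> B"
    and smult: "\<And>s a. a \<in> B \<Longrightarrow> s \<odot>\<^bsub>A\<^esub> a \<in> B"
  shows "unital_subalgebra A UNIV B"
proof -
  interpret A: ring A by (rule ring_ga)
  have "\<ominus>\<^bsub>A\<^esub> a \<in> B" if "a \<in> B" for a
  proof -
    have a: "a \<in> carrier A" using that assms(1) by blast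
    have "\<ominus>\<^bsub>A\<^esub> a = (-1) \<odot>\<^bsub>A\<^esub> a"
      by (rule A.minus_equality) (use a in \<open>auto simp: ga_smult ga_add ga_zero ga_carrier\<close>)
    then show ?thesis using smult[OF that] by simp
  qed
  then have "subring B A"
    using assms by (intro A.subringI) auto
  then show ?thesis
    using smult by (simp add: unital_subalgebra_def)
qed

lemma unital_subalgebraD:
  assumes "unital_subalgebra A UNIV B"
  shows "B \<subseteq> carrier A" and "\<one>\<^bsub>A\<^esub> \<in> B" and "\<zero>\<^bsub>A\<^esub> \<in> B"
    and "\<And>a b. a \<in> B \<Longrightarrow> b \<in> B \<Longrightarrow> a \<oplus>\<^bsub>A\<^esub> b \<in> B"
    and "\<And>a b. a \<in> B \<Longrightarrow> b \<in> B \<Longrightarrow> a \<otimes>\<^bsub>A\<^esub> b \<in> B"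
    and "\<And>s a. a \<in> B \<Longrightarrow> s \<odot>\<^bsub>A\<^esub> a \<in> B"
  using assms subringE[of B A] by (auto simp: unital_subalgebra_def)

lemma unital_subalgebra_sum:
  assumes "unital_subalgebra A UNIV B" and "finite I" and "\<And>i. i \<in> I \<Longrightarrow> f i \<in> B"
  shows "(\<lambda>x. \<Sum>i\<in>I. f i x) \<in> B"
  using assms(2,3)
proof (induction I rule: finite_induct)
  case empty
  then show ?case using unital_subalgebraD(3)[OF assms(1)] by (simp add: ga_zero)
next
  case (insert i I)
  then show ?case
    using unital_subalgebraD(4)[OF assms(1), of "f i" "\<lambda>x. \<Sum>i\<in>I. f i x"] by (simp add: ga_add)
qed

lemma unital_subalgebra_commutant:
  assumes "unital_subalgebra A UNIV S" and T: "T \<subseteq> carrier A"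
  shows "unital_subalgebra A UNIV (commutant A S T)"
proof (rule unital_subalgebraI)
  note S = unital_subalgebraD[OF assms(1)]
  show "commutant A S T \<subseteq> carrier A" "\<one>\<^bsub>A\<^esub> \<in> commutant A S T"
    using S(1,2) T by (auto simp: commutant_def conv_one_left conv_one_right subset_iff)
  fix a b s assume a: "a \<in> commutant A S T"
  show "s \<odot>\<^bsub>A\<^esub> a \<in> commutant A S T"
    using a S(6) by (auto simp: commutant_def conv_smult_left conv_smult_right)
  assume b: "b \<in> commutant A S T"
  show "a \<oplus>\<^bsub>A\<^esub> b \<in> commutant A S T"
    using a b S(4) by (auto simp: commutant_def conv_add_left conv_add_right)
  have "(a \<otimes>\<^bsub>A\<^esub> b) \<otimes>\<^bsub>A\<^esub> t = t \<otimes>\<^bsub>A\<^esub> (a \<otimes>\<^bsub>A\<^esub> b)" if "t \<in> T" for t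
  proof -
    have at: "a \<otimes>\<^bsub>A\<^esub> t = t \<otimes>\<^bsub>A\<^esub> a" and bt: "b \<otimes>\<^bsub>A\<^esub> t = t \<otimes>\<^bsub>A\<^esub> b"
      using a b that by (auto simp: commutant_def)
    have "(a \<otimes>\<^bsub>A\<^esub> b) \<otimes>\<^bsub>A\<^esub> t = (a \<otimes>\<^bsub>A\<^esub> t) \<otimes>\<^bsub>A\<^esub> b"
      by (simp only: conv_assoc bt)
    then show ?thesis by (simp only: at conv_assoc)
  qed
  then show "a \<otimes>\<^bsub>A\<^esub> b \<in> commutant A S T"
    using a b S(5) by (auto simp: commutant_def)
qed

lemma unital_subalgebra_ga_sub:
  assumes "subgroup H K"
  shows "unital_subalgebra A UNIV (ga_sub K H)"
proof (rule unital_subalgebraI)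
  interpret H: subgroup H K by (rule assms)
  show "ga_sub K H \<subseteq> carrier A" "\<one>\<^bsub>A\<^esub> \<in> ga_sub K H"
    by (auto simp: ga_sub_def ga_one ga_carrier)
  fix a b s assume a: "a \<in> ga_sub K H"
  show "s \<odot>\<^bsub>A\<^esub> a \<in> ga_sub K H"
    using a by (auto simp: ga_sub_def ga_smult ga_carrier)
  assume b: "b \<in> ga_sub K H"
  show "a \<oplus>\<^bsub>A\<^esub> b \<in> ga_sub K H"
    using a b by (auto simp: ga_sub_def ga_add ga_carrier)
  have "(a \<otimes>\<^bsub>A\<^esub> b) x = 0" if x: "x \<notin> H" for x
  proof (cases "x \<in> carrier K")
    case True
    have "a y * b (inv y \<otimes> x) = 0" if y: "y \<in> carrier K" for y
    proof (cases "y \<in> H")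
      case yH: True
      have "inv y \<otimes> x \<notin> H"
      proof
        assume "inv y \<otimes> x \<in> H"
        then have "y \<otimes> (inv y \<otimes> x) \<in> H" using yH by blast
        then show False using x y True by (simp add: m_assoc[symmetric])
      qed
      then show ?thesis using b by (simp add: ga_sub_def)
    qed (use a in \<open>simp add: ga_sub_def\<close>)
    then show ?thesis using True by (subst conv_left) (auto intro!: sum.neutral)
  qed (simp add: conv_outside)
  then show "a \<otimes>\<^bsub>A\<^esub> b \<in> ga_sub K H"
    by (simp add: ga_sub_def conv_closed)
qed

lemma unital_subalgebra_generated_subset:
  assumes "unital_subalgebra A UNIV B" "S \<subseteq> B"
  shows "generated_subalgebra A UNIV S \<subseteq> B"
  using assms by (auto simp: generated_subalgebra_def)

section \<open>Functions invariant under conjugation by a subgroup\<close>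

lemma ga_basis_conv:
  assumes "h \<in> carrier K" "x \<in> carrier K"
  shows "(ga_basis h \<otimes>\<^bsub>A\<^esub> a) x = a (inv h \<otimes> x)"
    and "(a \<otimes>\<^bsub>A\<^esub> ga_basis h) x = a (x \<otimes> inv h)"
proof -
  have *: "(if P then 1 else 0) * z = (if P then z else 0)"
    "z * (if P then 1 else 0) = (if P then z else 0)" for P and z :: complex
    by auto
  show "(ga_basis h \<otimes>\<^bsub>A\<^esub> a) x = a (inv h \<otimes> x)"
    using assms by (simp add: conv_left ga_basis_def *)
  show "(a \<otimes>\<^bsub>A\<^esub> ga_basis h) x = a (x \<otimes> inv h)"
    using assms by (simp add: conv_right ga_basis_def *)
qed

text \<open>It is enough to commute with the group elements of \<open>H\<close>, which form a basis of the algebra of \<open>H\<close>;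
  commuting with one of them is invariance of the coefficients under conjugation by it.\<close>

lemma commutant_ga_sub_iff:
  assumes H: "subgroup H K"
  shows "a \<in> commutant A S (ga_sub K H) \<longleftrightarrow>
    a \<in> S \<and> (\<forall>h\<in>H. \<forall>x\<in>carrier K. a (h \<otimes> x \<otimes> inv h) = a x)"
proof -
  have HK: "h \<in> carrier K" if "h \<in> H" for h
    using H that by (rule subgroup.mem_carrier)
  have conj: "a (h \<otimes> x \<otimes> inv h) = a x"
    if comm: "\<forall>b\<in>ga_sub K H. a \<otimes>\<^bsub>A\<^esub> b = b \<otimes>\<^bsub>A\<^esub> a" and h: "h \<in> H" and x: "x \<in> carrier K"
    for h x
  proof -
    have "ga_basis h \<in> ga_sub K H"
      using h HK by (auto simp: ga_sub_def ga_basis_def ga_carrier)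
    then have "(a \<otimes>\<^bsub>A\<^esub> ga_basis h) (h \<otimes> x) = (ga_basis h \<otimes>\<^bsub>A\<^esub> a) (h \<otimes> x)"
      using comm by metis
    then show ?thesis
      using x HK[OF h] by (simp add: ga_basis_conv m_assoc[symmetric])
  qed
  have comm: "a \<otimes>\<^bsub>A\<^esub> b = b \<otimes>\<^bsub>A\<^esub> a"
    if conj: "\<forall>h\<in>H. \<forall>x\<in>carrier K. a (h \<otimes> x \<otimes> inv h) = a x" and b: "b \<in> ga_sub K H" for b
  proof
    fix x show "(a \<otimes>\<^bsub>A\<^esub> b) x = (b \<otimes>\<^bsub>A\<^esub> a) x"
    proof (cases "x \<in> carrier K")
      case x: True
      have "a (x \<otimes> inv y) * b y = b y * a (inv y \<otimes> x)" if y: "y \<in> carrier K" for y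
      proof (cases "y \<in> H")
        case True
        then have "a (y \<otimes> (inv y \<otimes> x) \<otimes> inv y) = a (inv y \<otimes> x)"
          using conj x y by (intro conj[rule_format]) auto
        then show ?thesis using x y by (simp add: m_assoc[symmetric])
      next
        case False
        then show ?thesis using b by (simp add: ga_sub_def)
      qed
      then have "(\<Sum>y\<in>carrier K. a (x \<otimes> inv y) * b y) = (\<Sum>y\<in>carrier K. b y * a (inv y \<otimes> x))"
        by (rule sum.cong[OF refl])
      then show ?thesis using x by (simp only: conv_right[of x a b] conv_left[of x b a])
    qed (simp add: conv_outside)
  qed
  show ?thesis
    unfolding commutant_def using conj comm by blast
qed

text \<open>This is the sum over the \<open>H\<close>-conjugacy class of \<open>x\<close>, each element weighted by the order of the
  stabilizer of \<open>x\<close> in \<open>H\<close>. Indexing by \<open>H\<close> instead of by the class avoids any bookkeeping of orbits.\<close>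

definition conj_sum :: "'a set \<Rightarrow> 'a \<Rightarrow> 'a \<Rightarrow> complex" where
  "conj_sum H x = (\<lambda>z. \<Sum>h\<in>H. ga_basis (h \<otimes> x \<otimes> inv h) z)"

lemma sum_subgroup_mult_right:
  assumes H: "subgroup H K" and k: "k \<in> H"
  shows "(\<Sum>h\<in>H. f (h \<otimes> k)) = (\<Sum>h\<in>H. f h)"
proof -
  interpret H: subgroup H K by (rule H)
  show ?thesis
    by (rule sum.reindex_bij_witness[where j = "\<lambda>h. h \<otimes> k" and i = "\<lambda>h. h \<otimes> inv k"])
      (use k in \<open>auto simp: m_assoc\<close>)
qed

lemma sum_subgroup_mult_left:
  assumes H: "subgroup H K" and k: "k \<in> H"
  shows "(\<Sum>h\<in>H. f (k \<otimes> h)) = (\<Sum>h\<in>H. f h)"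
proof -
  interpret H: subgroup H K by (rule H)
  show ?thesis
    by (rule sum.reindex_bij_witness[where j = "\<lambda>h. k \<otimes> h" and i = "\<lambda>h. inv k \<otimes> h"])
      (use k in \<open>auto simp: m_assoc[symmetric]\<close>)
qed

lemma conj_sum_conj:
  assumes H: "subgroup H K" and k: "k \<in> H" and x: "x \<in> carrier K"
  shows "conj_sum H (k \<otimes> x \<otimes> inv k) = conj_sum H x"
proof
  fix z
  have HK: "h \<in> carrier K" if "h \<in> H" for h
    using H that by (rule subgroup.mem_carrier)
  have "conj_sum H (k \<otimes> x \<otimes> inv k) z
      = (\<Sum>h\<in>H. ga_basis ((h \<otimes> k) \<otimes> x \<otimes> inv (h \<otimes> k)) z)"
    unfolding conj_sum_def
    by (rule sum.cong) (use HK k x in \<open>auto simp: m_assoc inv_mult_group\<close>)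
  also have "\<dots> = conj_sum H x z"
    unfolding conj_sum_def by (rule sum_subgroup_mult_right[OF H k])
  finally show "conj_sum H (k \<otimes> x \<otimes> inv k) z = conj_sum H x z" .
qed

lemma conj_eq_iff:
  assumes "h \<in> carrier K" "x \<in> carrier K" "z \<in> carrier K"
  shows "z = h \<otimes> x \<otimes> inv h \<longleftrightarrow> inv h \<otimes> z \<otimes> h = x"
  using assms by (metis inv_closed inv_inv inv_solve_left inv_solve_right m_assoc m_closed)

lemma conj_sum_in_commutant:
  assumes H: "subgroup H K" and L: "subgroup L K" and "H \<subseteq> L" and x: "x \<in> L"
  shows "conj_sum H x \<in> commutant A (ga_sub K L) (ga_sub K H)"
  unfolding commutant_ga_sub_iff[OF H]
proof (intro conjI ballI)
  interpret H: subgroup H K by (rule H)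
  interpret L: subgroup L K by (rule L)
  have "conj_sum H x z = 0" if "z \<notin> L" for z
    unfolding conj_sum_def by (rule sum.neutral) (use assms that in \<open>auto simp: ga_basis_def\<close>)
  then show "conj_sum H x \<in> ga_sub K L"
    using L.subset by (auto simp: ga_sub_def ga_carrier)
  fix k z assume k: "k \<in> H" and z: "z \<in> carrier K"
  have "conj_sum H x (k \<otimes> z \<otimes> inv k)
      = (\<Sum>h\<in>H. ga_basis ((k \<otimes> h) \<otimes> x \<otimes> inv (k \<otimes> h)) (k \<otimes> z \<otimes> inv k))"
    unfolding conj_sum_def by (rule sum_subgroup_mult_left[OF H k, symmetric])
  also have "\<dots> = conj_sum H x z"
    unfolding conj_sum_def
  proof (rule sum.cong[OF refl])
    fix h assume h: "h \<in> H"
    have "(k \<otimes> h) \<otimes> x \<otimes> inv (k \<otimes> h) = k \<otimes> (h \<otimes> x \<otimes> inv h) \<otimes> inv k"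
      using h k x by (simp add: m_assoc inv_mult_group)
    then show "ga_basis ((k \<otimes> h) \<otimes> x \<otimes> inv (k \<otimes> h)) (k \<otimes> z \<otimes> inv k)
        = ga_basis (h \<otimes> x \<otimes> inv h) z"
      using h k x z by (simp add: ga_basis_def)
  qed
  finally show "conj_sum H x (k \<otimes> z \<otimes> inv k) = conj_sum H x z" .
qed

text \<open>Averaging an invariant \<open>a = (\<Sum>z\<in>L. a z \<cdot> z)\<close> over the conjugations by \<open>H\<close> reproduces \<open>a\<close> and
  replaces each \<open>z\<close> by \<open>conj_sum H z / card H\<close>.\<close>

lemma commutant_subset_span_conj_sums:
  assumes H: "subgroup H K" and "L \<subseteq> carrier K" and B: "unital_subalgebra A UNIV B"
    and sums: "\<And>x. x \<in> L \<Longrightarrow> conj_sum H x \<in> B"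
  shows "commutant A (ga_sub K L) (ga_sub K H) \<subseteq> B"
proof
  interpret H: subgroup H K by (rule H)
  have finH: "finite H" using H.subset finite_subset finite_carrier by blast
  have cardH: "card H > 0" using finH H.one_closed by (metis card_gt_0_iff empty_iff)
  fix a assume "a \<in> commutant A (ga_sub K L) (ga_sub K H)"
  then have aL: "a \<in> ga_sub K L" and inv: "\<And>h x. h \<in> H \<Longrightarrow> x \<in> carrier K \<Longrightarrow> a (h \<otimes> x \<otimes> inv h) = a x"
    by (auto simp: commutant_ga_sub_iff[OF H])
  have "a = (\<lambda>w. \<Sum>z\<in>L. ((a z / card H) \<odot>\<^bsub>A\<^esub> conj_sum H z) w)"
  proof
    fix w
    have "(\<Sum>z\<in>L. ((a z / card H) \<odot>\<^bsub>A\<^esub> conj_sum H z) w)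
        = (\<Sum>z\<in>carrier K. a z / card H * conj_sum H z w)"
      unfolding ga_smult
      by (rule sum.mono_neutral_left) (use aL assms(2) in \<open>auto simp: ga_sub_def\<close>)
    also have "\<dots> = (\<Sum>z\<in>carrier K. \<Sum>h\<in>H. a z / card H * ga_basis (h \<otimes> z \<otimes> inv h) w)"
      by (simp add: conj_sum_def sum_distrib_left)
    also have "\<dots> = (\<Sum>h\<in>H. \<Sum>z\<in>carrier K. a z / card H * ga_basis (h \<otimes> z \<otimes> inv h) w)"
      by (rule sum.swap)
    also have "\<dots> = (\<Sum>h\<in>H. a w / card H)"
    proof (rule sum.cong[OF refl])
      fix h assume h: "h \<in> H"
      show "(\<Sum>z\<in>carrier K. a z / card H * ga_basis (h \<otimes> z \<otimes> inv h) w) = a w / card H"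
      proof (cases "w \<in> carrier K")
        case w: True
        have "(\<Sum>z\<in>carrier K. a z / card H * ga_basis (h \<otimes> z \<otimes> inv h) w)
            = (\<Sum>z\<in>carrier K. if z = inv h \<otimes> w \<otimes> h then a z / card H else 0)"
          by (rule sum.cong) (use h w in \<open>auto simp: ga_basis_def conj_eq_iff\<close>)
        also have "\<dots> = a (inv h \<otimes> w \<otimes> h) / card H"
          using h w by simp
        also have "a (inv h \<otimes> w \<otimes> h) = a w"
          using inv[of "inv h" w] h w by simp
        finally show ?thesis .
      next
        case False
        then have "a w = 0" using aL by (auto simp: ga_sub_def ga_carrier)
        moreover have "ga_basis (h \<otimes> z \<otimes> inv h) w = 0" if "z \<in> carrier K" for z
          using False h that by (auto simp: ga_basis_def)
        ultimately show ?thesis by simp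
      qed
    qed
    also have "\<dots> = a w" using cardH by simp
    finally show "a w = (\<Sum>z\<in>L. ((a z / card H) \<odot>\<^bsub>A\<^esub> conj_sum H z) w)" by simp
  qed
  moreover have "(\<lambda>w. \<Sum>z\<in>L. ((a z / card H) \<odot>\<^bsub>A\<^esub> conj_sum H z) w) \<in> B"
    using finite_subset[OF assms(2) finite_carrier]
    by (intro unital_subalgebra_sum[OF B] unital_subalgebraD(6)[OF B] sums) auto
  ultimately show "a \<in> B" by simp
qed

text \<open>Because \<open>X\<close> commutes with every \<open>h \<in> H\<close>, one has \<open>(h x h\<^sup>-\<^sup>1) X = h (x X) h\<^sup>-\<^sup>1\<close>; then \<open>X\<close> is expanded
  into its summands.\<close>

lemma conj_sum_conv:
  assumes H: "subgroup H K" and x: "x \<in> carrier K"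
    and X: "X = (\<lambda>z. \<Sum>t\<in>T. ga_basis (f t) z)" and T: "\<And>t. t \<in> T \<Longrightarrow> f t \<in> carrier K"
    and inv: "\<And>h z. h \<in> H \<Longrightarrow> z \<in> carrier K \<Longrightarrow> X (h \<otimes> z \<otimes> inv h) = X z"
  shows "conj_sum H x \<otimes>\<^bsub>A\<^esub> X = (\<lambda>w. \<Sum>t\<in>T. conj_sum H (x \<otimes> f t) w)"
proof
  interpret H: subgroup H K by (rule H)
  fix w show "(conj_sum H x \<otimes>\<^bsub>A\<^esub> X) w = (\<Sum>t\<in>T. conj_sum H (x \<otimes> f t) w)"
  proof (cases "w \<in> carrier K")
    case w: True
    have "(conj_sum H x \<otimes>\<^bsub>A\<^esub> X) w
        = (\<Sum>y\<in>carrier K. \<Sum>h\<in>H. ga_basis (h \<otimes> x \<otimes> inv h) y * X (inv y \<otimes> w))"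
      using w by (simp add: conv_left conj_sum_def sum_distrib_right)
    also have "\<dots> = (\<Sum>h\<in>H. \<Sum>y\<in>carrier K. ga_basis (h \<otimes> x \<otimes> inv h) y * X (inv y \<otimes> w))"
      by (rule sum.swap)
    also have "\<dots> = (\<Sum>h\<in>H. \<Sum>t\<in>T. ga_basis (h \<otimes> (x \<otimes> f t) \<otimes> inv h) w)"
    proof (rule sum.cong[OF refl])
      fix h assume h: "h \<in> H"
      have "(\<Sum>y\<in>carrier K. ga_basis (h \<otimes> x \<otimes> inv h) y * X (inv y \<otimes> w))
          = (ga_basis (h \<otimes> x \<otimes> inv h) \<otimes>\<^bsub>A\<^esub> X) w"
        using w by (simp add: conv_left)
      also have "\<dots> = X (inv (h \<otimes> x \<otimes> inv h) \<otimes> w)"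
        using h x w by (simp add: ga_basis_conv)
      also have "inv (h \<otimes> x \<otimes> inv h) \<otimes> w = h \<otimes> (inv x \<otimes> (inv h \<otimes> w \<otimes> h)) \<otimes> inv h"
        using h x w by (simp add: m_assoc inv_mult_group)
      also have "X \<dots> = X (inv x \<otimes> (inv h \<otimes> w \<otimes> h))"
        using h x w by (simp add: inv)
      also have "\<dots> = (\<Sum>t\<in>T. ga_basis (h \<otimes> (x \<otimes> f t) \<otimes> inv h) w)"
        unfolding X
      proof (rule sum.cong[OF refl])
        fix t assume "t \<in> T"
        then have t: "f t \<in> carrier K" by (rule T)
        have "x \<otimes> f t = inv h \<otimes> w \<otimes> h \<longleftrightarrow> f t = inv x \<otimes> (inv h \<otimes> w \<otimes> h)"
          using h x w t by (intro inv_mult_eq_iff) auto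
        then have "inv x \<otimes> (inv h \<otimes> w \<otimes> h) = f t \<longleftrightarrow> inv h \<otimes> w \<otimes> h = x \<otimes> f t"
          by metis
        also have "\<dots> \<longleftrightarrow> w = h \<otimes> (x \<otimes> f t) \<otimes> inv h"
          using h x w t by (subst conj_eq_iff) auto
        finally show "ga_basis (f t) (inv x \<otimes> (inv h \<otimes> w \<otimes> h))
            = ga_basis (h \<otimes> (x \<otimes> f t) \<otimes> inv h) w"
          by (simp add: ga_basis_def)
      qed
      finally show "(\<Sum>y\<in>carrier K. ga_basis (h \<otimes> x \<otimes> inv h) y * X (inv y \<otimes> w))
          = (\<Sum>t\<in>T. ga_basis (h \<otimes> (x \<otimes> f t) \<otimes> inv h) w)" .
    qed
    also have "\<dots> = (\<Sum>t\<in>T. conj_sum H (x \<otimes> f t) w)"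
      unfolding conj_sum_def by (rule sum.swap)
    finally show ?thesis .
  next
    case False
    have "conj_sum H (x \<otimes> f t) w = 0" if "t \<in> T" for t
      unfolding conj_sum_def by (rule sum.neutral) (use False x T[OF that] in \<open>auto simp: ga_basis_def\<close>)
    then show ?thesis using False by (simp add: conv_outside)
  qed
qed

end

section \<open>Wreath products\<close>

lemma wreath_carrier:
  "(f, p) \<in> carrier (wreath G n) \<longleftrightarrow> f \<in> {1..n} \<rightarrow>\<^sub>E carrier G \<and> p permutes {1..n}"
  by (simp add: wreath_def sym_group_carrier)

lemma wreath_mult:
  "(f, p) \<otimes>\<^bsub>wreath G n\<^esub> (h, q) = ((\<lambda>i\<in>{1..n}. f i \<otimes>\<^bsub>G\<^esub> h (inv' p i)), p \<circ> q)"
  by (simp add: wreath_def sym_group_mult)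

lemma wreath_one: "\<one>\<^bsub>wreath G n\<^esub> = ((\<lambda>i\<in>{1..n}. \<one>\<^bsub>G\<^esub>), id)"
  by (simp add: wreath_def sym_group_one)

locale wreath_tower = G: group G for G :: "('a, 'x) monoid_scheme" (structure) +
  fixes n m :: nat
  assumes finite_G [simp]: "finite (carrier G)" and m_ge: "2 \<le> m" and m_le: "m \<le> n"
begin

abbreviation "W \<equiv> wreath G n"

lemma fst_wreath_closed: "(f, p) \<in> carrier W \<Longrightarrow> i \<in> {1..n} \<Longrightarrow> f i \<in> carrier G"
  by (auto simp: wreath_carrier)

lemma permutes_app_in: "p permutes S \<Longrightarrow> i \<in> S \<Longrightarrow> p i \<in> S"
  by (simp only: permutes_in_image)

lemma permutes_inv_app_in: "p permutes S \<Longrightarrow> i \<in> S \<Longrightarrow> inv' p i \<in> S"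
  by (simp only: permutes_in_image[OF permutes_inv])

lemma wreath_left_inv:
  assumes "(f, p) \<in> carrier W"
  shows "((\<lambda>i\<in>{1..n}. inv (f (p i))), inv' p) \<in> carrier W"
    and "((\<lambda>i\<in>{1..n}. inv (f (p i))), inv' p) \<otimes>\<^bsub>W\<^esub> (f, p) = \<one>\<^bsub>W\<^esub>"
proof -
  have f: "f \<in> {1..n} \<rightarrow>\<^sub>E carrier G" and p: "p permutes {1..n}"
    using assms by (auto simp: wreath_carrier)
  have fp: "f (p i) \<in> carrier G" if "i \<in> {1..n}" for i
    using f permutes_app_in[OF p that] by blast
  show "((\<lambda>i\<in>{1..n}. inv (f (p i))), inv' p) \<in> carrier W"
    using fp permutes_inv[OF p] by (auto simp: wreath_carrier)
  show "((\<lambda>i\<in>{1..n}. inv (f (p i))), inv' p) \<otimes>\<^bsub>W\<^esub> (f, p) = \<one>\<^bsub>W\<^esub>"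
    using fp p by (auto simp: wreath_mult wreath_one permutes_inv_inv permutes_inv_o fun_eq_iff)
qed

lemma group_wreath: "group W"
proof (rule groupI)
  show "\<one>\<^bsub>W\<^esub> \<in> carrier W" by (auto simp: wreath_one wreath_carrier permutes_id)
next
  fix x y assume x: "x \<in> carrier W" and y: "y \<in> carrier W"
  obtain f p h q where xy: "x = (f, p)" "y = (h, q)" by (metis surj_pair)
  have p: "p permutes {1..n}" "q permutes {1..n}" using x y xy by (auto simp: wreath_carrier)
  have "h (inv' p i) \<in> carrier G" if "i \<in> {1..n}" for i
    using y xy permutes_inv_app_in[OF p(1) that] fst_wreath_closed by blast
  then show "x \<otimes>\<^bsub>W\<^esub> y \<in> carrier W"
    using x y p by (auto simp: xy wreath_mult wreath_carrier intro!: permutes_compose)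
next
  fix x y z assume xyz: "x \<in> carrier W" "y \<in> carrier W" "z \<in> carrier W"
  obtain f p h q k r where eq: "x = (f, p)" "y = (h, q)" "z = (k, r)" by (metis surj_pair)
  have p: "p permutes {1..n}" and q: "q permutes {1..n}" using xyz eq by (auto simp: wreath_carrier)
  have inv_pq: "inv' (p \<circ> q) i = inv' q (inv' p i)" for i
    using p q by (simp add: o_inv_distrib permutes_bij)
  have "f i \<otimes> h (inv' p i) \<otimes> k (inv' q (inv' p i)) = f i \<otimes> (h (inv' p i) \<otimes> k (inv' q (inv' p i)))"
    if i: "i \<in> {1..n}" for i
  proof -
    have ip: "inv' p i \<in> {1..n}" by (rule permutes_inv_app_in[OF p i])
    show ?thesis
      using xyz fst_wreath_closed i ip permutes_inv_app_in[OF q ip] unfolding eq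
      by (intro G.m_assoc) blast+
  qed
  then show "x \<otimes>\<^bsub>W\<^esub> y \<otimes>\<^bsub>W\<^esub> z = x \<otimes>\<^bsub>W\<^esub> (y \<otimes>\<^bsub>W\<^esub> z)"
    using permutes_inv_app_in[OF p]
    by (auto simp: eq wreath_mult inv_pq fun_eq_iff)
next
  fix x assume x: "x \<in> carrier W"
  obtain f p where eq: "x = (f, p)" by (metis surj_pair)
  show "\<one>\<^bsub>W\<^esub> \<otimes>\<^bsub>W\<^esub> x = x"
    using x by (auto simp: eq wreath_one wreath_mult wreath_carrier PiE_iff extensional_def fun_eq_iff)
  show "\<exists>y\<in>carrier W. y \<otimes>\<^bsub>W\<^esub> x = \<one>\<^bsub>W\<^esub>"
    using wreath_left_inv[OF x[unfolded eq]] eq by blast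
qed

sublocale W: finite_group W
proof (unfold finite_group_def finite_group_axioms_def, intro conjI group_wreath)
  show "finite (carrier W)"
    by (auto simp: wreath_def sym_group_def intro!: finite_PiE finite_permutations)
qed

lemma wreath_inv:
  assumes "(f, p) \<in> carrier W"
  shows "inv\<^bsub>W\<^esub> (f, p) = ((\<lambda>i\<in>{1..n}. inv (f (p i))), inv' p)"
  using wreath_left_inv[OF assms] assms by (intro W.inv_equality)

lemma subgroup_wr_sub: "subgroup (wr_sub G i n) W"
proof (rule W.subgroupI)
  show "wr_sub G i n \<subseteq> carrier W" by (auto simp: wr_sub_def)
  have "\<one>\<^bsub>W\<^esub> \<in> wr_sub G i n"
    using W.one_closed by (simp add: wr_sub_def wreath_one)
  then show "wr_sub G i n \<noteq> {}" by blast
  fix x assume x: "x \<in> wr_sub G i n"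
  obtain f p where eq: "x = (f, p)" by (metis surj_pair)
  have xW: "(f, p) \<in> carrier W" and fix_p: "\<And>j. j \<in> {i + 1..n} \<Longrightarrow> p j = j"
    using x eq by (auto simp: wr_sub_def)
  have p: "p permutes {1..n}" using xW by (simp add: wreath_carrier)
  have "inv' p j = j" if "j \<in> {i + 1..n}" for j
    using fix_p[OF that] permutes_inv_eq[OF p] by blast
  then show "inv\<^bsub>W\<^esub> x \<in> wr_sub G i n"
    using wreath_left_inv(1)[OF xW] by (simp add: eq wreath_inv[OF xW] wr_sub_def)
  fix y assume y: "y \<in> wr_sub G i n"
  obtain h q where eq': "y = (h, q)" by (metis surj_pair)
  have "x \<otimes>\<^bsub>W\<^esub> y \<in> carrier W" using x y by (auto simp: wr_sub_def)
  then show "x \<otimes>\<^bsub>W\<^esub> y \<in> wr_sub G i n"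
    using x y by (auto simp: eq eq' wr_sub_def wreath_mult)
qed

abbreviation "H \<equiv> wr_sub G (m - 1) n"
abbreviation "L \<equiv> wr_sub G m n"

lemma H_subset_L: "H \<subseteq> L"
  by (auto simp: wr_sub_def)

lemma H_permutes:
  assumes "(f, p) \<in> H"
  shows "p permutes {1..<m}"
proof (rule permutes_superset)
  show "p permutes {1..n}" using assms by (auto simp: wr_sub_def wreath_carrier)
  show "\<And>x. x \<in> {1..n} - {1..<m} \<Longrightarrow> p x = x" using assms by (auto simp: wr_sub_def)
qed

lemma L_permutes:
  assumes "(f, p) \<in> L"
  shows "p permutes {1..m}"
proof (rule permutes_superset)
  show "p permutes {1..n}" using assms by (auto simp: wr_sub_def wreath_carrier)
  show "\<And>x. x \<in> {1..n} - {1..m} \<Longrightarrow> p x = x" using assms by (auto simp: wr_sub_def)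
qed

section \<open>The summands of the Young--Jucys--Murphy element\<close>

text \<open>Written as a monomial matrix with entries in \<open>G\<close>, this exchanges the coordinates \<open>j\<close> and \<open>m\<close>, with the
  mutually inverse entries \<open>inv g\<close> and \<open>g\<close>; this is why it is an involution.\<close>

definition reflection :: "nat \<Rightarrow> 'a \<Rightarrow> 'a wreath_elem" where
  "reflection j g =
     ((\<lambda>i\<in>{1..n}. if i = j then inv g else if i = m then g else \<one>), transpose j m)"

lemma reflection_in_L:
  assumes "j \<in> {1..<m}" "g \<in> carrier G"
  shows "reflection j g \<in> L"
  using assms m_le
  by (auto simp: reflection_def wr_sub_def wreath_carrier intro!: permutes_swap_id)

lemma reflection_closed: "j \<in> {1..<m} \<Longrightarrow> g \<in> carrier G \<Longrightarrow> reflection j g \<in> carrier W"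
  using subgroup.subset[OF subgroup_wr_sub] reflection_in_L by blast

lemma YJM_eq:
  "YJM G n m = (\<lambda>z. \<Sum>t\<in>{1..<m} \<times> carrier G. ga_basis (reflection (fst t) (snd t)) z)"
proof
  fix z
  have "wr_base G n k (inv g) \<otimes>\<^bsub>W\<^esub> wr_base G n m g \<otimes>\<^bsub>W\<^esub> wr_perm G n (transpose k m) = reflection k g"
    if "k \<in> {1..<m}" "g \<in> carrier G" for k g
    using that m_le
    by (auto simp: wr_base_def wr_perm_def reflection_def wreath_mult fun_eq_iff)
  then show "YJM G n m z = (\<Sum>t\<in>{1..<m} \<times> carrier G. ga_basis (reflection (fst t) (snd t)) z)"
    by (simp add: YJM_def sum.cartesian_product case_prod_unfold)
qed

lemma reflection_involution:
  assumes "j \<in> {1..<m}" "g \<in> carrier G"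
  shows "reflection j g \<otimes>\<^bsub>W\<^esub> reflection j g = \<one>\<^bsub>W\<^esub>"
  using assms m_le
  by (auto simp: reflection_def wreath_mult wreath_one fun_eq_iff transpose_def)

text \<open>Under conjugation by a monomial matrix whose permutation fixes \<open>m\<close>, the exchanged pair \<open>j\<close>, \<open>m\<close> becomes
  \<open>p j\<close>, \<open>m\<close>, and the two entries change to another mutually inverse pair. The proof compares entries of
  the two sides multiplied on the right by \<open>(f, p)\<close>, which avoids computing with the inverse.\<close>

lemma conj_reflection:
  assumes h: "(f, p) \<in> H" and j: "j \<in> {1..<m}" and g: "g \<in> carrier G"
  shows "(f, p) \<otimes>\<^bsub>W\<^esub> reflection j g \<otimes>\<^bsub>W\<^esub> inv\<^bsub>W\<^esub> (f, p)
    = reflection (p j) (f m \<otimes> g \<otimes> inv (f (p j)))"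
proof -
  have hW: "(f, p) \<in> carrier W" using h by (auto simp: wr_sub_def)
  have p: "p permutes {1..<m}" by (rule H_permutes[OF h])
  have pj: "p j \<in> {1..<m}" by (rule permutes_app_in[OF p j])
  have fC: "f i \<in> carrier G" if "i \<in> {1..n}" for i using fst_wreath_closed[OF hW that] .
  have pm: "p m = m" "inv' p m = m"
    using p permutes_inv[OF p] by (auto intro: permutes_not_in)
  have inv_eq: "inv' p i = k \<longleftrightarrow> i = p k" for i k
    using permutes_inv_eq[OF p] by metis
  have mem: "m \<in> {1..n}" "p j \<in> {1..n}" "j \<in> {1..n}" using pj j m_le by auto
  have g': "f m \<otimes> g \<otimes> inv (f (p j)) \<in> carrier G"
    using fC[OF mem(1)] fC[OF mem(2)] g by simp
  have perm: "p \<circ> transpose j m = transpose (p j) m \<circ> p"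
    using pm(1) permutes_inj[OF p] by (auto simp: fun_eq_iff transpose_def inj_eq)
  have base: "f i \<otimes> (if inv' p i = j then inv g else if inv' p i = m then g else \<one>)
      = (if i = p j then inv (f m \<otimes> g \<otimes> inv (f (p j)))
         else if i = m then f m \<otimes> g \<otimes> inv (f (p j)) else \<one>) \<otimes> f (transpose (p j) m i)"
    if i: "i \<in> {1..n}" for i
    using fC[OF mem(1)] fC[OF mem(2)] fC[OF i] g pj pm
    by (auto simp: inv_eq transpose_def G.inv_mult_group G.m_assoc)
  have "(f, p) \<otimes>\<^bsub>W\<^esub> reflection j g = reflection (p j) (f m \<otimes> g \<otimes> inv (f (p j))) \<otimes>\<^bsub>W\<^esub> (f, p)"
  proof -
    have "inv' p i \<in> {1..n}" if "i \<in> {1..n}" for i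
      using hW permutes_inv_app_in[OF _ that] by (simp add: wreath_carrier)
    then show ?thesis
      unfolding reflection_def wreath_mult perm
      using base by (auto simp: fun_eq_iff restrict_def)
  qed
  then show ?thesis
    using hW reflection_closed[OF j g] reflection_closed[OF pj g']
    by (metis W.inv_closed W.inv_solve_right W.m_closed)
qed

text \<open>For fixed \<open>h = (f, p)\<close> the map \<open>(j, g) \<mapsto> (p j, f m \<otimes> g \<otimes> inv (f (p j)))\<close> of the previous lemma is a
  bijection of the index set, so conjugation by \<open>h\<close> only permutes the summands.\<close>

lemma YJM_conj_invariant:
  assumes h: "h \<in> H" and z: "z \<in> carrier W"
  shows "YJM G n m (h \<otimes>\<^bsub>W\<^esub> z \<otimes>\<^bsub>W\<^esub> inv\<^bsub>W\<^esub> h) = YJM G n m z"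
proof -
  obtain f p where eq: "h = (f, p)" by (metis surj_pair)
  have hH: "(f, p) \<in> H" using h eq by simp
  have hW: "h \<in> carrier W" using h by (auto simp: wr_sub_def)
  have p: "p permutes {1..<m}" by (rule H_permutes[OF hH])
  have fC: "f i \<in> carrier G" if "i \<in> {1..m}" for i
    using fst_wreath_closed hW that m_le eq by auto
  have fm: "f m \<in> carrier G" using fC m_ge by simp
  have fj: "f j \<in> carrier G" if "j \<in> {1..<m}" for j using fC that by auto
  let ?T = "{1..<m} \<times> carrier G"
  have "YJM G n m z = (\<Sum>t\<in>?T. ga_basis (reflection (fst t) (snd t)) z)"
    by (simp add: YJM_eq)
  also have "\<dots> = (\<Sum>t\<in>?T. ga_basis (reflection (fst t) (snd t)) (h \<otimes>\<^bsub>W\<^esub> z \<otimes>\<^bsub>W\<^esub> inv\<^bsub>W\<^esub> h))"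
  proof (rule sum.reindex_bij_witness[where
        j = "\<lambda>(j, g). (p j, f m \<otimes> g \<otimes> inv (f (p j)))" and
        i = "\<lambda>(j, g). (inv' p j, inv (f m) \<otimes> g \<otimes> f j)"])
    fix t assume "t \<in> ?T"
    then obtain j g where t: "t = (j, g)" and j: "j \<in> {1..<m}" and g: "g \<in> carrier G" by auto
    have pj: "p j \<in> {1..<m}" by (rule permutes_app_in[OF p j])
    have ipj: "inv' p j \<in> {1..<m}" by (rule permutes_inv_app_in[OF p j])
    note C = fm fj[OF j] fj[OF pj] g
    show "(case case t of (j, g) \<Rightarrow> (p j, f m \<otimes> g \<otimes> inv (f (p j))) of
        (j, g) \<Rightarrow> (inv' p j, inv (f m) \<otimes> g \<otimes> f j)) = t"
      using C by (simp add: t permutes_inverses[OF p] G.m_assoc G.inv_solve_left')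
    show "(case case t of (j, g) \<Rightarrow> (inv' p j, inv (f m) \<otimes> g \<otimes> f j) of
        (j, g) \<Rightarrow> (p j, f m \<otimes> g \<otimes> inv (f (p j)))) = t"
      using C by (simp add: t permutes_inverses[OF p] G.m_assoc[symmetric])
         (simp add: G.m_assoc)
    show "(case t of (j, g) \<Rightarrow> (p j, f m \<otimes> g \<otimes> inv (f (p j)))) \<in> ?T"
      using C pj by (simp add: t)
    show "(case t of (j, g) \<Rightarrow> (inv' p j, inv (f m) \<otimes> g \<otimes> f j)) \<in> ?T"
      using C ipj by (simp add: t)
    have "h \<otimes>\<^bsub>W\<^esub> reflection j g \<otimes>\<^bsub>W\<^esub> inv\<^bsub>W\<^esub> h = h \<otimes>\<^bsub>W\<^esub> z \<otimes>\<^bsub>W\<^esub> inv\<^bsub>W\<^esub> h \<longleftrightarrow> reflection j g = z"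
      using hW z reflection_closed[OF j g] by simp
    then show "ga_basis (reflection (fst (case t of (j, g) \<Rightarrow> (p j, f m \<otimes> g \<otimes> inv (f (p j)))))
          (snd (case t of (j, g) \<Rightarrow> (p j, f m \<otimes> g \<otimes> inv (f (p j)))))) (h \<otimes>\<^bsub>W\<^esub> z \<otimes>\<^bsub>W\<^esub> inv\<^bsub>W\<^esub> h)
        = ga_basis (reflection (fst t) (snd t)) z"
      using conj_reflection[OF hH j g] by (auto simp: t eq ga_basis_def)
  qed
  also have "\<dots> = YJM G n m (h \<otimes>\<^bsub>W\<^esub> z \<otimes>\<^bsub>W\<^esub> inv\<^bsub>W\<^esub> h)"
    by (simp add: YJM_eq)
  finally show ?thesis by simp
qed

lemma YJM_in_rel_commutant: "YJM G n m \<in> wr_rel_commutant G m (m - 1) n"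
  unfolding wr_rel_commutant_def W.commutant_ga_sub_iff[OF subgroup_wr_sub]
proof (intro conjI ballI)
  have "YJM G n m z = 0" if "z \<notin> L" for z
    unfolding YJM_eq by (rule sum.neutral) (use reflection_in_L that in \<open>auto simp: ga_basis_def\<close>)
  then show "YJM G n m \<in> ga_sub W L"
    by (auto simp: ga_sub_def W.ga_carrier wr_sub_def)
qed (rule YJM_conj_invariant)

section \<open>Generating the class sums\<close>

text \<open>The cardinality of this set is the induction measure. The position \<open>m\<close> is left out because every
  multiplication by a reflection changes the image of \<open>m\<close>.\<close>

definition moved :: "'a wreath_elem \<Rightarrow> nat set" where
  "moved x = {i \<in> {1..<m}. snd x i \<noteq> i \<or> fst x i \<noteq> \<one>}"

lemma finite_moved [simp]: "finite (moved x)"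
  by (simp add: moved_def)

lemma moved_mult_reflection:
  assumes x: "x \<in> carrier W" and j: "j \<in> {1..<m}" and g: "g \<in> carrier G"
  shows "moved (x \<otimes>\<^bsub>W\<^esub> reflection j g) \<subseteq> insert j (moved x)"
proof
  fix i assume i: "i \<in> moved (x \<otimes>\<^bsub>W\<^esub> reflection j g)"
  obtain f p where eq: "x = (f, p)" by (metis surj_pair)
  have p: "p permutes {1..n}" using x by (simp add: eq wreath_carrier)
  have i': "i \<in> {1..<m}" "i \<in> {1..n}" using i m_le by (auto simp: moved_def)
  show "i \<in> insert j (moved x)"
  proof (rule ccontr)
    assume "i \<notin> insert j (moved x)"
    then have *: "i \<noteq> j" "p i = i" "f i = \<one>" using i' by (auto simp: eq moved_def)
    then have "inv' p i = i" using permutes_inv_eq[OF p] by blast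
    then have "i \<notin> moved (x \<otimes>\<^bsub>W\<^esub> reflection j g)"
      using * i' by (simp add: eq moved_def reflection_def wreath_mult)
    then show False using i by blast
  qed
qed

text \<open>The conjugating element exchanges \<open>i\<close> and \<open>j\<close> and carries a single label at \<open>i\<close>. As \<open>x\<close> acts trivially at
  both positions, the two commute, so only the reflection is affected; its new label is
  \<open>g \<otimes> inv c\<close>, and \<open>c\<close> is chosen to make this \<open>g'\<close>.\<close>

lemma mult_reflection_conj:
  assumes x: "x \<in> L"
    and i: "i \<in> {1..<m}" "i \<notin> moved x" and j: "j \<in> {1..<m}" "j \<notin> moved x"
    and g: "g \<in> carrier G" "g' \<in> carrier G"
  shows "\<exists>h\<in>H. x \<otimes>\<^bsub>W\<^esub> reflection i g' = h \<otimes>\<^bsub>W\<^esub> (x \<otimes>\<^bsub>W\<^esub> reflection j g) \<otimes>\<^bsub>W\<^esub> inv\<^bsub>W\<^esub> h"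
proof -
  obtain f p where eq: "x = (f, p)" by (metis surj_pair)
  have xW: "x \<in> carrier W" using x by (auto simp: wr_sub_def)
  have p: "p permutes {1..n}" using xW by (simp add: eq wreath_carrier)
  have fC: "f k \<in> carrier G" if "k \<in> {1..n}" for k
    using fst_wreath_closed xW that eq by auto
  have fixed: "p i = i" "p j = j" "f i = \<one>" "f j = \<one>"
    using i j by (auto simp: moved_def eq)
  have inv_eq: "inv' p k = l \<longleftrightarrow> k = p l" for k l
    using permutes_inv_eq[OF p] by metis
  have p_eq: "p k = i \<longleftrightarrow> k = i" "p k = j \<longleftrightarrow> k = j" for k
    using fixed(1,2) permutes_inj[OF p] by (metis injD)+
  have mem: "i \<in> {1..n}" "j \<in> {1..n}" "i \<noteq> m" using i j m_le by auto
  define c where "c = inv g' \<otimes> g"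
  define b where "b = (\<lambda>k\<in>{1..n}. if k = i then c else \<one>)"
  define h where "h = (b, transpose i j)"
  have c: "c \<in> carrier G" using g by (simp add: c_def)
  have hH: "h \<in> H"
    using c i j m_le unfolding h_def b_def
    by (auto simp: wr_sub_def wreath_carrier transpose_def intro!: permutes_swap_id)
  have hW: "h \<in> carrier W" using hH by (auto simp: wr_sub_def)
  have perm: "transpose i j \<circ> p = p \<circ> transpose i j"
    by (simp add: fun_eq_iff transpose_def fixed p_eq)
  have base: "b k \<otimes> f (transpose i j k) = f k \<otimes> b (inv' p k)" if k: "k \<in> {1..n}" for k
  proof -
    have "inv' p k \<in> {1..n}" by (rule permutes_inv_app_in[OF p k])
    then show ?thesis
      using k c fC[OF k] fixed mem by (auto simp: b_def inv_eq transpose_def)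
  qed
  have comm: "h \<otimes>\<^bsub>W\<^esub> x = x \<otimes>\<^bsub>W\<^esub> h"
    using base by (auto simp: h_def eq wreath_mult perm fun_eq_iff)
  have "h \<otimes>\<^bsub>W\<^esub> reflection j g \<otimes>\<^bsub>W\<^esub> inv\<^bsub>W\<^esub> h
      = reflection (transpose i j j) (b m \<otimes> g \<otimes> inv (b (transpose i j j)))"
    using conj_reflection[OF hH[unfolded h_def] j(1) g(1)] by (simp add: h_def)
  also have "\<dots> = reflection i g'"
    using g mem m_le m_ge by (simp add: b_def c_def G.inv_mult_group G.m_assoc[symmetric])
  finally have "x \<otimes>\<^bsub>W\<^esub> reflection i g' = x \<otimes>\<^bsub>W\<^esub> (h \<otimes>\<^bsub>W\<^esub> reflection j g \<otimes>\<^bsub>W\<^esub> inv\<^bsub>W\<^esub> h)" by simp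
  also have "\<dots> = (x \<otimes>\<^bsub>W\<^esub> h) \<otimes>\<^bsub>W\<^esub> reflection j g \<otimes>\<^bsub>W\<^esub> inv\<^bsub>W\<^esub> h"
    using xW hW reflection_closed[OF j(1) g(1)] by (simp add: W.m_assoc)
  also have "\<dots> = h \<otimes>\<^bsub>W\<^esub> (x \<otimes>\<^bsub>W\<^esub> reflection j g) \<otimes>\<^bsub>W\<^esub> inv\<^bsub>W\<^esub> h"
    using xW hW reflection_closed[OF j(1) g(1)] by (simp add: comm[symmetric] W.m_assoc)
  finally show ?thesis using hH by blast
qed

text \<open>The position \<open>i = p m\<close> is the one following \<open>m\<close> in its cycle; multiplying by the reflection in \<open>i\<close> cuts \<open>i\<close>
  out of that cycle, and the label \<open>inv (f i)\<close> of the reflection cancels the label of \<open>x\<close> at \<open>i\<close>.\<close>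

lemma factor_reflection:
  assumes x: "x \<in> L" and "snd x m \<noteq> m"
  obtains y i g where "y \<in> L" "i \<in> {1..<m}" "g \<in> carrier G" "x = y \<otimes>\<^bsub>W\<^esub> reflection i g"
    "i \<notin> moved y" "card (moved y) < card (moved x)"
proof -
  obtain f p where eq: "x = (f, p)" by (metis surj_pair)
  have xL: "(f, p) \<in> L" and pm: "p m \<noteq> m" using assms eq by auto
  have xW: "x \<in> carrier W" using x by (auto simp: wr_sub_def)
  have p: "p permutes {1..n}" using xW by (simp add: eq wreath_carrier)
  define i where "i = p m"
  have "i \<in> {1..m}" unfolding i_def using permutes_app_in[OF L_permutes[OF xL]] m_ge by simp
  then have i: "i \<in> {1..<m}" using pm i_def by auto
  have i_n: "i \<in> {1..n}" using i m_le by auto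
  have fi: "f i \<in> carrier G" using fst_wreath_closed xW i_n eq by blast
  define g where "g = inv (f i)"
  have g: "g \<in> carrier G" using fi by (simp add: g_def)
  define y where "y = x \<otimes>\<^bsub>W\<^esub> reflection i g"
  have y: "y \<in> L"
    unfolding y_def using subgroup.m_closed[OF subgroup_wr_sub x reflection_in_L[OF i g]] .
  have "y \<otimes>\<^bsub>W\<^esub> reflection i g = x"
    using xW reflection_closed[OF i g] by (simp add: y_def W.m_assoc reflection_involution[OF i g])
  have "inv' p i = m" using permutes_inv_eq[OF p] i_def by metis
  then have i_fixed: "i \<notin> moved y"
    using i i_n m_le fi pm unfolding y_def eq moved_def reflection_def wreath_mult g_def
    by (auto simp: i_def)
  have "p i \<noteq> i" using permutes_inj[OF p] pm unfolding i_def by (metis injD)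
  then have "i \<in> moved x" using i by (simp add: moved_def eq)
  then have "moved y \<subset> moved x"
    using moved_mult_reflection[OF xW i g] i_fixed unfolding y_def by blast
  then have "card (moved y) < card (moved x)" by (intro psubset_card_mono) auto
  then show ?thesis
    using that[OF y i g] \<open>y \<otimes>\<^bsub>W\<^esub> reflection i g = x\<close> i_fixed by simp
qed

text \<open>The heart of the argument. In the inductive step, \<open>T1\<close> indexes the reflections at positions that \<open>y\<close>
  leaves alone, each contributing one copy of the sought sum, and \<open>T2\<close> those that bring no new active
  position.\<close>

lemma conj_sum_in_subalgebra:
  assumes B: "unital_subalgebra W.A UNIV B"
    and center: "wr_center G (m - 1) n \<subseteq> B" and X: "YJM G n m \<in> B"
    and "x \<in> L"
  shows "W.conj_sum H x \<in> B"
  using \<open>x \<in> L\<close>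
proof (induction "card (moved x)" arbitrary: x rule: less_induct)
  case less
  note H = subgroup_wr_sub[of "m - 1"]
  show ?case
  proof (cases "snd x m = m")
    case True
    have "x \<in> H"
    proof -
      have "snd x j = j" if "j \<in> {m - 1 + 1..n}" for j
        using True less.prems that by (cases "j = m") (auto simp: wr_sub_def)
      then show ?thesis using less.prems by (auto simp: wr_sub_def)
    qed
    then show ?thesis
      using W.conj_sum_in_commutant[OF H H order_refl, of x] center unfolding wr_center_def by blast
  next
    case False
    obtain y i g where y: "y \<in> L" and i: "i \<in> {1..<m}" and g: "g \<in> carrier G"
      and xy: "x = y \<otimes>\<^bsub>W\<^esub> reflection i g" and iy: "i \<notin> moved y"
      and card: "card (moved y) < card (moved x)"
      using factor_reflection[OF less.prems False] .
    have yW: "y \<in> carrier W" using y by (auto simp: wr_sub_def)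
    define T where "T = {1..<m} \<times> carrier G"
    define T1 where "T1 = ({1..<m} - moved y) \<times> carrier G"
    define T2 where "T2 = moved y \<times> carrier G"
    have T: "T = T1 \<union> T2" "T1 \<inter> T2 = {}" "finite T1" "finite T2"
      by (auto simp: T_def T1_def T2_def moved_def)
    let ?S = "W.conj_sum H"
    let ?r = "\<lambda>t. reflection (fst t) (snd t)"
    have S1: "?S (y \<otimes>\<^bsub>W\<^esub> ?r t) = ?S x" if "t \<in> T1" for t
    proof -
      have t: "fst t \<in> {1..<m}" "fst t \<notin> moved y" "snd t \<in> carrier G"
        using that by (auto simp: T1_def)
      obtain h where h: "h \<in> H"
        and "y \<otimes>\<^bsub>W\<^esub> ?r t = h \<otimes>\<^bsub>W\<^esub> (y \<otimes>\<^bsub>W\<^esub> reflection i g) \<otimes>\<^bsub>W\<^esub> inv\<^bsub>W\<^esub> h"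
        using mult_reflection_conj[OF y t(1,2) i iy g t(3)] by blast
      then show ?thesis
        using W.conj_sum_conj[OF H h] less.prems by (auto simp: xy wr_sub_def)
    qed
    have S2: "?S (y \<otimes>\<^bsub>W\<^esub> ?r t) \<in> B" if "t \<in> T2" for t
    proof (rule less.hyps)
      have t: "fst t \<in> {1..<m}" "fst t \<in> moved y" "snd t \<in> carrier G"
        using that by (auto simp: T2_def moved_def)
      have "moved (y \<otimes>\<^bsub>W\<^esub> ?r t) \<subseteq> moved y"
        using moved_mult_reflection[OF yW t(1,3)] t(2) by blast
      then show "card (moved (y \<otimes>\<^bsub>W\<^esub> ?r t)) < card (moved x)"
        using card card_mono[OF finite_moved] by (metis order_le_less_trans)
      show "y \<otimes>\<^bsub>W\<^esub> ?r t \<in> L"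
        using subgroup.m_closed[OF subgroup_wr_sub y reflection_in_L[OF t(1,3)]] .
    qed
    define R where "R = (\<lambda>w. \<Sum>t\<in>T2. ?S (y \<otimes>\<^bsub>W\<^esub> ?r t) w)"
    have R: "R \<in> B"
      unfolding R_def by (rule W.unital_subalgebra_sum[OF B T(4) S2])
    have P: "?S y \<otimes>\<^bsub>W.A\<^esub> YJM G n m \<in> B"
      using less.hyps[OF card y] X by (rule W.unital_subalgebraD(5)[OF B])
    have P_eq: "?S y \<otimes>\<^bsub>W.A\<^esub> YJM G n m = (\<lambda>w. of_nat (card T1) * ?S x w + R w)"
    proof -
      have "?S y \<otimes>\<^bsub>W.A\<^esub> YJM G n m = (\<lambda>w. \<Sum>t\<in>T. ?S (y \<otimes>\<^bsub>W\<^esub> ?r t) w)"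
        unfolding T_def
        by (rule W.conj_sum_conv[OF H yW YJM_eq])
          (auto intro!: reflection_closed YJM_conj_invariant)
      then show ?thesis
        using T S1 by (simp add: R_def sum.union_disjoint)
    qed
    have "(i, g) \<in> T1" using i iy g by (simp add: T1_def)
    then have "card T1 > 0" using T(3) by (metis card_gt_0_iff empty_iff)
    then have "?S x = (1 / of_nat (card T1)) \<odot>\<^bsub>W.A\<^esub>
        ((?S y \<otimes>\<^bsub>W.A\<^esub> YJM G n m) \<oplus>\<^bsub>W.A\<^esub> ((-1) \<odot>\<^bsub>W.A\<^esub> R))"
      unfolding P_eq by (simp add: W.ga_smult W.ga_add)
    also have "\<dots> \<in> B"
      by (intro W.unital_subalgebraD(4,6)[OF B] P R)
    finally show ?thesis .
  qed
qed

lemma unital_subalgebra_rel_commutant: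
  "unital_subalgebra W.A UNIV (wr_rel_commutant G m (m - 1) n)"
  unfolding wr_rel_commutant_def
  by (intro W.unital_subalgebra_commutant W.unital_subalgebra_ga_sub subgroup_wr_sub)
    (auto simp: ga_sub_def)

lemma center_subset_rel_commutant: "wr_center G (m - 1) n \<subseteq> wr_rel_commutant G m (m - 1) n"
  using H_subset_L by (auto simp: wr_center_def wr_rel_commutant_def commutant_def ga_sub_def)

lemma rel_commutant_subset:
  assumes "unital_subalgebra W.A UNIV B" "wr_center G (m - 1) n \<union> {YJM G n m} \<subseteq> B"
  shows "wr_rel_commutant G m (m - 1) n \<subseteq> B"
  unfolding wr_rel_commutant_def
  using assms
  by (intro W.commutant_subset_span_conj_sums subgroup_wr_sub conj_sum_in_subalgebra)
    (auto simp: wr_sub_def)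

theorem rel_commutant_generated:
  "wr_rel_commutant G m (m - 1) n =
     generated_subalgebra W.A UNIV (wr_center G (m - 1) n \<union> {YJM G n m})"
proof
  show "wr_rel_commutant G m (m - 1) n
      \<subseteq> generated_subalgebra W.A UNIV (wr_center G (m - 1) n \<union> {YJM G n m})"
    using rel_commutant_subset by (auto simp: generated_subalgebra_def)
  show "generated_subalgebra W.A UNIV (wr_center G (m - 1) n \<union> {YJM G n m})
      \<subseteq> wr_rel_commutant G m (m - 1) n"
    by (intro W.unital_subalgebra_generated_subset unital_subalgebra_rel_commutant)
      (use center_subset_rel_commutant YJM_in_rel_commutant in auto)
qed

text \<open>A set commuting with the generators commutes with the algebra they generate. This is used twice:
  first for the single element \<open>YJM G n m\<close>, which commutes with the center because it lies in \<open>Z\<close>,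
  then for all of \<open>Z\<close>.\<close>

theorem rel_commutant_commutative:
  assumes a: "a \<in> wr_rel_commutant G m (m - 1) n" and b: "b \<in> wr_rel_commutant G m (m - 1) n"
  shows "a \<otimes>\<^bsub>W.A\<^esub> b = b \<otimes>\<^bsub>W.A\<^esub> a"
proof -
  define Z where "Z = wr_rel_commutant G m (m - 1) n"
  have Z: "unital_subalgebra W.A UNIV Z"
    unfolding Z_def by (rule unital_subalgebra_rel_commutant)
  have Z_sub: "Z \<subseteq> carrier W.A" by (rule W.unital_subalgebraD(1)[OF Z])
  have gens: "wr_center G (m - 1) n \<subseteq> Z" "YJM G n m \<in> Z"
    unfolding Z_def by (rule center_subset_rel_commutant, rule YJM_in_rel_commutant)
  have center_comm: "c \<otimes>\<^bsub>W.A\<^esub> z = z \<otimes>\<^bsub>W.A\<^esub> c" if "c \<in> wr_center G (m - 1) n" "z \<in> Z" for c z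
    using that by (auto simp: Z_def wr_center_def wr_rel_commutant_def commutant_def)
  have "Z \<subseteq> commutant W.A Z {YJM G n m}"
    using rel_commutant_subset[OF W.unital_subalgebra_commutant[OF Z, of "{YJM G n m}"]]
      gens Z_sub center_comm by (auto simp: Z_def commutant_def)
  then have "YJM G n m \<in> commutant W.A Z Z"
    using gens(2) by (auto simp: commutant_def)
  then have "Z \<subseteq> commutant W.A Z Z"
    using rel_commutant_subset[OF W.unital_subalgebra_commutant[OF Z Z_sub]]
      gens center_comm by (auto simp: Z_def commutant_def)
  then show ?thesis
    using a b by (auto simp: Z_def commutant_def)
qed

end

theorem theorem4p3:
  fixes G :: "('a, 'x) monoid_scheme" and n m :: nat
  assumes "group G" and "finite (carrier G)" and "n \<ge> 2" and "2 \<le> m" and "m \<le> n"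
  shows "wr_rel_commutant G m (m - 1) n =
           generated_subalgebra (wr_alg G n) UNIV (wr_center G (m - 1) n \<union> {YJM G n m})
         \<and> (\<forall>a \<in> wr_rel_commutant G m (m - 1) n. \<forall>b \<in> wr_rel_commutant G m (m - 1) n.
              a \<otimes>\<^bsub>wr_alg G n\<^esub> b = b \<otimes>\<^bsub>wr_alg G n\<^esub> a)"
proof -
  interpret wreath_tower G n m
    using assms by (simp add: wreath_tower_def wreath_tower_axioms_def)
  show ?thesis
    using rel_commutant_generated rel_commutant_commutative by blast
qed

end
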